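(* Let $S$ be a numerical monoid. Then the Grothendieck group of $\mathcal P_{\mathrm{fin}}(S)$ is isomorphic to $\mathbb Z\oplus\mathbb Z$, and the Grothendieck group of $\mathcal P_{\mathrm{fin},0}(S)$ is isomorphic to $\mathbb Z$.
   Context: A numerical monoid is an additive submonoid $S\subset\mathbb N_0$ with $\gcd(S)=1$. $\mathcal P_{\mathrm{fin}}(S)$ is the commutative monoid of all finite nonempty subsets of $S$ with set addition $A+B=\{a+b\colon a\in A,b\in B\}$ (identity $\{0\}$), and $\mathcal P_{\mathrm{fin},0}(S)$ is its submonoid of sets containing $0$. For a commutative monoid $H$, its Grothendieck group is an abelian group $\mathrm{gp}(H)$ together with a monoid homomorphism $\iota\colon H\to\mathrm{gp}(H)$ such that every monoid homomorphism from $H$ into an abelian group $G$ factors uniquely as $\psi\circ\iota$ with $\psi\colon\mathrm{gp}(H)\to G$ a group homomorphism (equivalently, $\mathrm{gp}(H)$ is the set of classes of pairs $(A,B)\in H\times H$ under $(A,B)\sim(C,D)$ iff $A+D+E=C+B+E$ for some $E\in H$). *)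

theory Defs
  imports "HOL-Algebra.Elementary_Groups" "HOL-Library.Set_Algebras"
begin

section \<open>The Grothendieck group of a commutative monoid\<close>

definition groth_rel :: "('a, 'm) monoid_scheme \<Rightarrow> (('a \<times> 'a) \<times> ('a \<times> 'a)) set" where
  "groth_rel H = {((a, b), (c, d)).
     a \<in> carrier H \<and> b \<in> carrier H \<and> c \<in> carrier H \<and> d \<in> carrier H \<and>
     (\<exists>e\<in>carrier H. a \<otimes>\<^bsub>H\<^esub> d \<otimes>\<^bsub>H\<^esub> e = c \<otimes>\<^bsub>H\<^esub> b \<otimes>\<^bsub>H\<^esub> e)}"

text \<open>The class of \<open>(a, b)\<close> is the formal difference of \<open>a\<close> and \<open>b\<close>.\<close>

definition groth_class :: "('a, 'm) monoid_scheme \<Rightarrow> 'a \<Rightarrow> 'a \<Rightarrow> ('a \<times> 'a) set" where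
  "groth_class H a b = groth_rel H `` {(a, b)}"

text \<open>
  The union in the multiplication ranges over all representatives of the two classes;
  all its members coincide, see \<open>groth_mult_class\<close> below.
\<close>

definition groth_group :: "('a, 'm) monoid_scheme \<Rightarrow> ('a \<times> 'a) set monoid" where
  "groth_group H =
     \<lparr>carrier = (carrier H \<times> carrier H) // groth_rel H,
      monoid.mult = (\<lambda>X Y. \<Union>(a, b)\<in>X. \<Union>(c, d)\<in>Y. groth_class H (a \<otimes>\<^bsub>H\<^esub> c) (b \<otimes>\<^bsub>H\<^esub> d)),
      one = groth_class H \<one>\<^bsub>H\<^esub> \<one>\<^bsub>H\<^esub>\<rparr>"

definition groth_map :: "('a, 'm) monoid_scheme \<Rightarrow> 'a \<Rightarrow> ('a \<times> 'a) set" where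
  "groth_map H a = groth_class H a \<one>\<^bsub>H\<^esub>"

context comm_monoid
begin

lemma groth_rel_equiv: "equiv (carrier G \<times> carrier G) (groth_rel G)"
proof (rule equivI)
  show "groth_rel G \<subseteq> (carrier G \<times> carrier G) \<times> (carrier G \<times> carrier G)"
    by (auto simp: groth_rel_def)
  show "refl_on (carrier G \<times> carrier G) (groth_rel G)"
    by (auto simp: groth_rel_def refl_on_def)
  show "sym (groth_rel G)"
    by (rule symI) (auto simp: groth_rel_def intro: sym)
  show "trans (groth_rel G)"
  proof (rule transI, clarify)
    fix a b c d e f
    assume "((a, b), (c, d)) \<in> groth_rel G" "((c, d), (e, f)) \<in> groth_rel G"
    then obtain x y where cl: "a \<in> carrier G" "b \<in> carrier G" "c \<in> carrier G" "d \<in> carrier G"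
      "e \<in> carrier G" "f \<in> carrier G" "x \<in> carrier G" "y \<in> carrier G"
      and 1: "a \<otimes> d \<otimes> x = c \<otimes> b \<otimes> x" and 2: "c \<otimes> f \<otimes> y = e \<otimes> d \<otimes> y"
      by (auto simp: groth_rel_def)
    have "a \<otimes> f \<otimes> (d \<otimes> x \<otimes> y) = (a \<otimes> d \<otimes> x) \<otimes> (f \<otimes> y)"
      using cl by (simp add: m_ac)
    also have "\<dots> = (c \<otimes> f \<otimes> y) \<otimes> (b \<otimes> x)"
      unfolding 1 using cl by (simp add: m_ac)
    also have "\<dots> = e \<otimes> b \<otimes> (d \<otimes> x \<otimes> y)"
      unfolding 2 using cl by (simp add: m_ac)
    finally show "((a, b), (e, f)) \<in> groth_rel G"
      using cl by (auto simp: groth_rel_def intro!: bexI[of _ "d \<otimes> x \<otimes> y"])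
  qed
qed

lemma groth_class_eq_iff:
  assumes "a \<in> carrier G" "b \<in> carrier G" "c \<in> carrier G" "d \<in> carrier G"
  shows "groth_class G a b = groth_class G c d \<longleftrightarrow>
         (\<exists>e\<in>carrier G. a \<otimes> d \<otimes> e = c \<otimes> b \<otimes> e)"
  using assms eq_equiv_class_iff[OF groth_rel_equiv, of "(a, b)" "(c, d)"]
  by (simp add: groth_class_def groth_rel_def)

lemma groth_class_closed:
  "a \<in> carrier G \<Longrightarrow> b \<in> carrier G \<Longrightarrow> groth_class G a b \<in> carrier (groth_group G)"
  by (auto simp: groth_group_def groth_class_def intro!: quotientI)

lemma groth_carrierE:
  assumes "X \<in> carrier (groth_group G)"
  obtains a b where "a \<in> carrier G" "b \<in> carrier G" "X = groth_class G a b"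
  using assms by (auto simp: groth_group_def groth_class_def elim!: quotientE)

lemma groth_mult_class:
  assumes cl: "a \<in> carrier G" "b \<in> carrier G" "c \<in> carrier G" "d \<in> carrier G"
  shows "groth_class G a b \<otimes>\<^bsub>groth_group G\<^esub> groth_class G c d = groth_class G (a \<otimes> c) (b \<otimes> d)"
proof -
  have *: "groth_class G (a' \<otimes> c') (b' \<otimes> d') = groth_class G (a \<otimes> c) (b \<otimes> d)"
    if "(a', b') \<in> groth_class G a b" "(c', d') \<in> groth_class G c d" for a' b' c' d'
  proof -
    from that obtain x y where cl': "a' \<in> carrier G" "b' \<in> carrier G" "c' \<in> carrier G" "d' \<in> carrier G"
      "x \<in> carrier G" "y \<in> carrier G"
      and 1: "a \<otimes> b' \<otimes> x = a' \<otimes> b \<otimes> x" and 2: "c \<otimes> d' \<otimes> y = c' \<otimes> d \<otimes> y"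
      by (auto simp: groth_class_def groth_rel_def)
    have "(a' \<otimes> c') \<otimes> (b \<otimes> d) \<otimes> (x \<otimes> y) = (a' \<otimes> b \<otimes> x) \<otimes> (c' \<otimes> d \<otimes> y)"
      using cl cl' by (simp add: m_ac)
    also have "\<dots> = (a \<otimes> c) \<otimes> (b' \<otimes> d') \<otimes> (x \<otimes> y)"
      unfolding 1[symmetric] 2[symmetric] using cl cl' by (simp add: m_ac)
    finally show ?thesis
      using cl cl' by (subst groth_class_eq_iff) (auto intro!: bexI[of _ "x \<otimes> y"])
  qed
  have self: "(a, b) \<in> groth_class G a b" "(c, d) \<in> groth_class G c d"
    using cl by (auto simp: groth_class_def groth_rel_def)
  have "groth_class G a b \<otimes>\<^bsub>groth_group G\<^esub> groth_class G c d =
    (\<Union>(a', b')\<in>groth_class G a b. \<Union>(c', d')\<in>groth_class G c d. groth_class G (a' \<otimes> c') (b' \<otimes> d'))"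
    by (simp add: groth_group_def)
  also have "\<dots> = groth_class G (a \<otimes> c) (b \<otimes> d)"
    using * self by fast
  finally show ?thesis .
qed

lemma groth_one: "\<one>\<^bsub>groth_group G\<^esub> = groth_class G \<one> \<one>"
  by (simp add: groth_group_def)

lemma groth_comm_group: "comm_group (groth_group G)"
proof (rule comm_groupI)
  fix X assume "X \<in> carrier (groth_group G)"
  then obtain a b where X: "a \<in> carrier G" "b \<in> carrier G" "X = groth_class G a b"
    by (rule groth_carrierE)
  have "groth_class G b a \<otimes>\<^bsub>groth_group G\<^esub> X = \<one>\<^bsub>groth_group G\<^esub>"
    using X by (auto simp: groth_mult_class groth_one groth_class_eq_iff m_comm)
  then show "\<exists>Y\<in>carrier (groth_group G). Y \<otimes>\<^bsub>groth_group G\<^esub> X = \<one>\<^bsub>groth_group G\<^esub>"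
    using X groth_class_closed by blast
qed (auto elim!: groth_carrierE simp: groth_mult_class groth_one groth_class_closed m_ac)

lemma groth_map_hom: "groth_map G \<in> hom G (groth_group G)"
  by (auto simp: hom_def groth_map_def groth_class_closed groth_mult_class)

lemma groth_map_one: "groth_map G \<one> = \<one>\<^bsub>groth_group G\<^esub>"
  by (simp add: groth_map_def groth_one)

text \<open>
  The universal property. Maps in \<open>hom\<close> are unconstrained outside the carrier,
  so uniqueness is stated for the extensional ones.
\<close>

theorem groth_universal:
  assumes K: "comm_group K" and f: "f \<in> hom G K"
  shows "\<exists>!\<psi>. \<psi> \<in> hom (groth_group G) K \<and> \<psi> \<in> extensional (carrier (groth_group G)) \<and>
               (\<forall>a\<in>carrier G. \<psi> (groth_map G a) = f a)"
proof -
  interpret K: comm_group K by fact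
  have fc: "f a \<in> carrier K" if "a \<in> carrier G" for a
    using f that by (rule hom_in_carrier)
  have fm: "f (a \<otimes> b) = f a \<otimes>\<^bsub>K\<^esub> f b" if "a \<in> carrier G" "b \<in> carrier G" for a b
    using f that by (rule hom_mult)
  have f1: "f \<one> = \<one>\<^bsub>K\<^esub>"
  proof -
    have "f \<one> \<otimes>\<^bsub>K\<^esub> f \<one> = f \<one>"
      using fm[OF one_closed one_closed] unfolding l_one[OF one_closed] by (rule sym)
    then show ?thesis
      by (simp only: K.r_cancel_one fc one_closed)
  qed
  define \<psi> where "\<psi> = (\<lambda>X\<in>carrier (groth_group G).
    THE k. \<exists>a\<in>carrier G. \<exists>b\<in>carrier G. X = groth_class G a b \<and> k = f a \<otimes>\<^bsub>K\<^esub> inv\<^bsub>K\<^esub> f b)"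
  have \<psi>: "\<psi> (groth_class G a b) = f a \<otimes>\<^bsub>K\<^esub> inv\<^bsub>K\<^esub> f b" if ab: "a \<in> carrier G" "b \<in> carrier G" for a b
  proof -
    have eq: "f c \<otimes>\<^bsub>K\<^esub> inv\<^bsub>K\<^esub> f d = f a \<otimes>\<^bsub>K\<^esub> inv\<^bsub>K\<^esub> f b"
      if cd: "c \<in> carrier G" "d \<in> carrier G" "groth_class G a b = groth_class G c d" for c d
    proof -
      obtain e where e: "e \<in> carrier G" "a \<otimes> d \<otimes> e = c \<otimes> b \<otimes> e"
        using cd(3) groth_class_eq_iff[OF ab cd(1,2)] by blast
      have "f (a \<otimes> d \<otimes> e) = f (c \<otimes> b \<otimes> e)" by (simp only: e(2))
      then have "(f a \<otimes>\<^bsub>K\<^esub> f d) \<otimes>\<^bsub>K\<^esub> f e = (f c \<otimes>\<^bsub>K\<^esub> f b) \<otimes>\<^bsub>K\<^esub> f e"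
        using ab cd e(1) by (simp only: fm m_closed)
      then have "f a \<otimes>\<^bsub>K\<^esub> f d = f c \<otimes>\<^bsub>K\<^esub> f b"
        by (rule K.right_cancel[THEN iffD1, rotated 3]) (use ab cd e(1) fc in auto)
      then have "f a = f c \<otimes>\<^bsub>K\<^esub> f b \<otimes>\<^bsub>K\<^esub> inv\<^bsub>K\<^esub> f d"
        by (subst K.inv_solve_right) (simp_all add: fc ab cd)
      then have "f a = (f c \<otimes>\<^bsub>K\<^esub> inv\<^bsub>K\<^esub> f d) \<otimes>\<^bsub>K\<^esub> f b"
        by (simp only: K.m_ac fc ab cd K.inv_closed)
      then show ?thesis
        by (simp only: K.inv_solve_right fc ab cd K.inv_closed K.m_closed)
    qed
    have "(THE k. \<exists>c\<in>carrier G. \<exists>d\<in>carrier G. groth_class G a b = groth_class G c d \<and>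
            k = f c \<otimes>\<^bsub>K\<^esub> inv\<^bsub>K\<^esub> f d) = f a \<otimes>\<^bsub>K\<^esub> inv\<^bsub>K\<^esub> f b"
      by (rule the_equality) (use ab in blast, elim bexE conjE, simp only: eq)
    then show ?thesis
      using groth_class_closed[OF ab] by (simp add: \<psi>_def)
  qed
  show ?thesis
  proof (rule ex1I[of _ \<psi>])
    show "\<psi> \<in> hom (groth_group G) K \<and> \<psi> \<in> extensional (carrier (groth_group G)) \<and>
          (\<forall>a\<in>carrier G. \<psi> (groth_map G a) = f a)"
    proof (intro conjI ballI)
      show "\<psi> \<in> hom (groth_group G) K"
      proof (rule homI)
        fix X assume "X \<in> carrier (groth_group G)"
        then show "\<psi> X \<in> carrier K"
          by (elim groth_carrierE) (simp add: \<psi> fc)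
      next
        fix X Y assume "X \<in> carrier (groth_group G)" "Y \<in> carrier (groth_group G)"
        then show "\<psi> (X \<otimes>\<^bsub>groth_group G\<^esub> Y) = \<psi> X \<otimes>\<^bsub>K\<^esub> \<psi> Y"
          by (elim groth_carrierE) (simp add: \<psi> groth_mult_class fm fc K.inv_mult K.m_ac)
      qed
      show "\<psi> \<in> extensional (carrier (groth_group G))"
        by (simp add: \<psi>_def)
      show "\<psi> (groth_map G a) = f a" if "a \<in> carrier G" for a
        using that by (simp add: groth_map_def \<psi> f1 fc)
    qed
  next
    fix \<phi>
    assume \<phi>: "\<phi> \<in> hom (groth_group G) K \<and> \<phi> \<in> extensional (carrier (groth_group G)) \<and>
               (\<forall>a\<in>carrier G. \<phi> (groth_map G a) = f a)"
    show "\<phi> = \<psi>"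
    proof (rule extensionalityI)
      show "\<phi> \<in> extensional (carrier (groth_group G))" using \<phi> by blast
      show "\<psi> \<in> extensional (carrier (groth_group G))" by (simp add: \<psi>_def)
    next
      fix X assume "X \<in> carrier (groth_group G)"
      then obtain a b where X: "a \<in> carrier G" "b \<in> carrier G" "X = groth_class G a b"
        by (rule groth_carrierE)
      have "X \<otimes>\<^bsub>groth_group G\<^esub> groth_map G b = groth_map G a"
        using X by (auto simp: groth_map_def groth_mult_class groth_class_eq_iff m_ac)
      then have "\<phi> X \<otimes>\<^bsub>K\<^esub> f b = f a"
        using \<phi> X groth_class_closed hom_mult[of \<phi> "groth_group G" K X "groth_map G b"]
        by (simp add: groth_map_def)
      moreover have "\<phi> X \<in> carrier K"
        using \<phi> X groth_class_closed by (blast intro: hom_in_carrier)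
      ultimately have "\<phi> X = f a \<otimes>\<^bsub>K\<^esub> inv\<^bsub>K\<^esub> f b"
        by (subst K.inv_solve_right) (auto simp: X fc)
      then show "\<phi> X = \<psi> X" using X \<psi> by simp
    qed
  qed
qed

end


section \<open>Numerical monoids and their power monoids\<close>

definition numerical_monoid :: "nat set \<Rightarrow> bool" where
  "numerical_monoid S \<longleftrightarrow> 0 \<in> S \<and> (\<forall>x\<in>S. \<forall>y\<in>S. x + y \<in> S) \<and> Gcd S = 1"

text \<open>Addition of sets is the elementwise one of \<^theory>\<open>HOL-Library.Set_Algebras\<close>.\<close>

definition Pfin :: "nat set \<Rightarrow> nat set monoid" where
  "Pfin S = \<lparr>carrier = {A. A \<subseteq> S \<and> finite A \<and> A \<noteq> {}}, monoid.mult = (+), one = {0}\<rparr>"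

definition Pfin0 :: "nat set \<Rightarrow> nat set monoid" where
  "Pfin0 S = Pfin S\<lparr>carrier := {A \<in> carrier (Pfin S). 0 \<in> A}\<rparr>"

lemma Pfin_plus_closed:
  assumes "numerical_monoid S" "A \<in> carrier (Pfin S)" "B \<in> carrier (Pfin S)"
  shows "A + B \<in> carrier (Pfin S)"
proof -
  have "A + B \<subseteq> S"
    using assms by (auto simp: Pfin_def numerical_monoid_def elim!: set_plus_elim)
  moreover have "A + B \<noteq> {}"
    using assms set_plus_intro by (fastforce simp: Pfin_def)
  ultimately show ?thesis
    using assms by (simp add: Pfin_def finite_set_plus)
qed

lemma comm_monoid_Pfin:
  assumes "numerical_monoid S"
  shows "comm_monoid (Pfin S)"
proof (rule comm_monoidI)
  show "A \<otimes>\<^bsub>Pfin S\<^esub> B \<in> carrier (Pfin S)" if "A \<in> carrier (Pfin S)" "B \<in> carrier (Pfin S)" for A B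
    using Pfin_plus_closed[OF assms that] by (simp add: Pfin_def)
  show "\<one>\<^bsub>Pfin S\<^esub> \<in> carrier (Pfin S)"
    using assms by (simp add: Pfin_def numerical_monoid_def)
qed (simp_all add: Pfin_def add_ac flip: set_zero)

lemma submonoid_Pfin0:
  assumes "numerical_monoid S"
  shows "submonoid {A \<in> carrier (Pfin S). 0 \<in> A} (Pfin S)"
proof (rule submonoid.intro)
  show "A \<otimes>\<^bsub>Pfin S\<^esub> B \<in> {A \<in> carrier (Pfin S). 0 \<in> A}"
    if "A \<in> {A \<in> carrier (Pfin S). 0 \<in> A}" "B \<in> {A \<in> carrier (Pfin S). 0 \<in> A}" for A B
    using Pfin_plus_closed[OF assms, of A B] that set_plus_intro[of 0 A 0 B]
    by (auto simp: Pfin_def)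
  show "\<one>\<^bsub>Pfin S\<^esub> \<in> {A \<in> carrier (Pfin S). 0 \<in> A}"
    using assms by (simp add: Pfin_def numerical_monoid_def)
qed auto

lemma comm_monoid_Pfin0:
  assumes "numerical_monoid S"
  shows "comm_monoid (Pfin0 S)"
  unfolding Pfin0_def
  by (rule comm_monoid.submonoid_is_comm_monoid[OF comm_monoid_Pfin submonoid_Pfin0]) (fact assms)+

end

theory Submission
  imports Defs
begin

text \<open>
  The map \<open>A \<mapsto> (max A, min A)\<close> is a homomorphism into \<open>\<int> \<oplus> \<int>\<close>, and it identifies \<open>A\<close> and \<open>B\<close>
  only if \<open>A + E = B + E\<close> for some \<open>E\<close>: since \<open>S\<close> is cofinite, \<open>E\<close> can be taken to be a long
  interval beyond the conductor, which fills all gaps between the minimum and the maximum.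
  When all sets must contain \<open>0\<close>, an initial segment of \<open>S\<close> plays the role of the interval.
\<close>

text \<open>The homomorphism induced by \<open>f\<close> sends the class of \<open>(a, b)\<close> to
  the difference of \<open>f a\<close> and \<open>f b\<close>. It is injective because, by
  \<open>inj\<close>, \<open>f\<close> identifies only elements that become equal after adding a
  common \<open>e\<close>. It is onto because \<open>surj\<close> writes each \<open>k\<close> as
  such a difference, with \<open>f b\<close> moved to the other side to avoid inverses.\<close>

lemma (in comm_monoid) groth_group_iso:
  assumes K: "comm_group K" and f: "f \<in> hom G K"
    and inj: "\<And>a b. \<lbrakk>a \<in> carrier G; b \<in> carrier G; f a = f b\<rbrakk> \<Longrightarrow> \<exists>e\<in>carrier G. a \<otimes> e = b \<otimes> e"
    and surj: "\<And>k. k \<in> carrier K \<Longrightarrow> \<exists>a\<in>carrier G. \<exists>b\<in>carrier G. k \<otimes>\<^bsub>K\<^esub> f b = f a"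
  shows "groth_group G \<cong> K"
proof -
  interpret K: comm_group K by fact
  have fc: "f a \<in> carrier K" if "a \<in> carrier G" for a
    using f that by (rule hom_in_carrier)
  have fm: "f (a \<otimes> b) = f a \<otimes>\<^bsub>K\<^esub> f b" if "a \<in> carrier G" "b \<in> carrier G" for a b
    using f that by (rule hom_mult)
  obtain \<psi> where hom: "\<psi> \<in> hom (groth_group G) K"
    and \<psi>: "\<And>a. a \<in> carrier G \<Longrightarrow> \<psi> (groth_map G a) = f a"
    using groth_universal[OF K f] by blast
  have \<psi>c: "\<psi> (groth_class G a b) \<in> carrier K" if "a \<in> carrier G" "b \<in> carrier G" for a b
    using hom groth_class_closed[OF that] by (rule hom_in_carrier)
  have eq: "\<psi> (groth_class G a b) \<otimes>\<^bsub>K\<^esub> f b = f a" if ab: "a \<in> carrier G" "b \<in> carrier G" for a b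
  proof -
    have "groth_class G a b \<otimes>\<^bsub>groth_group G\<^esub> groth_map G b = groth_map G a"
      using ab by (auto simp: groth_map_def groth_mult_class groth_class_eq_iff m_ac)
    moreover have "groth_map G b \<in> carrier (groth_group G)"
      using ab by (simp add: groth_map_def groth_class_closed)
    ultimately show ?thesis
      using hom_mult[OF hom groth_class_closed[OF ab]] \<psi> ab by metis
  qed
  have "inj_on \<psi> (carrier (groth_group G))"
  proof (rule inj_onI)
    fix X Y
    assume "X \<in> carrier (groth_group G)" "Y \<in> carrier (groth_group G)" and XY: "\<psi> X = \<psi> Y"
    then obtain a b c d where cl: "a \<in> carrier G" "b \<in> carrier G" "c \<in> carrier G" "d \<in> carrier G"
      and X: "X = groth_class G a b" and Y: "Y = groth_class G c d"
      by (meson groth_carrierE)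
    \<comment> \<open>Moving the subtracted terms across turns equality of the two differences into
      equality of two values of \<open>f\<close>. The \<open>e\<close> that \<open>inj\<close> then
      supplies is the one that equality of the classes asks for.\<close>
    have "f (a \<otimes> d) = \<psi> X \<otimes>\<^bsub>K\<^esub> f b \<otimes>\<^bsub>K\<^esub> f d"
      using cl by (simp add: fm eq X)
    also have "\<dots> = \<psi> Y \<otimes>\<^bsub>K\<^esub> f d \<otimes>\<^bsub>K\<^esub> f b"
      using cl unfolding XY by (simp add: Y K.m_ac fc \<psi>c)
    also have "\<dots> = f (c \<otimes> b)"
      using cl by (simp add: fm eq Y)
    finally show "X = Y"
      using inj[of "a \<otimes> d" "c \<otimes> b"] cl by (simp add: X Y groth_class_eq_iff)
  qed
  moreover have "\<psi> ` carrier (groth_group G) = carrier K"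
  proof (intro equalityI subsetI)
    fix k assume k: "k \<in> carrier K"
    then obtain a b where ab: "a \<in> carrier G" "b \<in> carrier G" "k \<otimes>\<^bsub>K\<^esub> f b = f a"
      using surj by blast
    then have "\<psi> (groth_class G a b) = k"
      using eq[of a b] k K.right_cancel[of "f b"] fc \<psi>c by metis
    then show "k \<in> \<psi> ` carrier (groth_group G)"
      using groth_class_closed ab by blast
  qed (use hom hom_in_carrier in fastforce)
  ultimately have "\<psi> \<in> iso (groth_group G) K"
    using hom by (simp add: iso_def bij_betw_def)
  then show ?thesis by (rule is_isoI)
qed

lemma numerical_monoid_mult:
  assumes "numerical_monoid S" "x \<in> S"
  shows "n * x \<in> S"
  using assms by (induction n) (auto simp: numerical_monoid_def)

text \<open>The least positive difference of two elements of \<open>S\<close> divides every element of \<open>S\<close>.\<close>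

lemma numerical_monoid_consecutive:
  assumes S: "numerical_monoid S"
  obtains t where "t \<in> S" "Suc t \<in> S"
proof -
  have add: "x + y \<in> S" if "x \<in> S" "y \<in> S" for x y
    using S that by (simp add: numerical_monoid_def)
  define P where "P d \<longleftrightarrow> d > 0 \<and> (\<exists>t\<in>S. t + d \<in> S)" for d
  define d where "d = (LEAST d. P d)"
  \<comment> \<open>A positive \<open>x\<close> in \<open>S\<close>, paired with \<open>0\<close>,
    shows that positive differences exist, so that the minimum \<open>d\<close> makes sense.\<close>
  have "\<exists>x\<in>S. x > 0"
  proof (rule ccontr)
    assume "\<not> (\<exists>x\<in>S. x > 0)"
    then have "\<forall>x\<in>S. x = 0" by simp
    then have "S \<subseteq> {0}" by blast
    then have "Gcd S = 0" by simp
    then show False using S unfolding numerical_monoid_def by linarith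
  qed
  then obtain x where "x \<in> S" "x > 0" by blast
  then have "P x"
    using S by (auto simp: P_def numerical_monoid_def intro!: bexI[of _ 0])
  then have "P d" unfolding d_def by (rule LeastI)
  then obtain t where d: "d > 0" and t: "t \<in> S" "t + d \<in> S"
    by (auto simp: P_def)
  have "d dvd s" if s: "s \<in> S" for s
  proof (rule ccontr)
    assume "\<not> d dvd s"
    then have r: "s mod d > 0" by (simp add: mod_greater_zero_iff_not_dvd)
    \<comment> \<open>With q = \<open>s div d\<close>, the remainder \<open>s mod d\<close> is the
      difference of s + q t and q (t + d), both in \<open>S\<close>. It is smaller than
      \<open>d\<close>, so it must vanish.\<close>
    have "s div d * (t + d) + s mod d = s + s div d * t"
      by (simp add: algebra_simps)
    then have "s div d * (t + d) + s mod d \<in> S"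
      using add numerical_monoid_mult[OF S] s t(1) by simp
    then have "P (s mod d)"
      using r numerical_monoid_mult[OF S t(2)] by (auto simp: P_def)
    then have "d \<le> s mod d" unfolding d_def by (rule Least_le)
    then show False using d mod_less_divisor[of d s] by linarith
  qed
  then have "d dvd Gcd S" by (rule Gcd_greatest)
  then have "d = 1" using S by (simp add: numerical_monoid_def)
  then show thesis using t that by simp
qed

text \<open>If t and t + 1 lie in \<open>S\<close>, then so does q t + r = (q - r) t + r (t + 1)
  whenever r \<le> q. For n \<ge> t * t with t > 0, the quotient q of n by t is at least t, hence
  exceeds the remainder r.\<close>

lemma numerical_monoid_conductor:
  assumes S: "numerical_monoid S"
  obtains c where "{c..} \<subseteq> S"
proof -
  obtain t where t: "t \<in> S" "Suc t \<in> S"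
    using numerical_monoid_consecutive[OF S] .
  have "n \<in> S" if n: "t * t \<le> n" for n
  proof (cases "t = 0")
    \<comment> \<open>Here \<open>Suc t\<close> is 1, so \<open>S\<close> contains every natural
      number.\<close>
    case True
    then show ?thesis using numerical_monoid_mult[OF S t(2), of n] by simp
  next
    case False
    then have le: "n mod t \<le> n div t"
      using n by (metis div_le_mono div_mult_self_is_m le_trans less_imp_le mod_less_divisor neq0_conv)
    then obtain d where "n div t = n mod t + d"
      using le_Suc_ex by blast
    then have "n = (n mod t + d) * t + n mod t"
      using div_mult_mod_eq[of n t] by metis
    also have "\<dots> = d * t + n mod t * Suc t"
      by (simp add: add_mult_distrib)
    also have "\<dots> \<in> S"
      using numerical_monoid_mult[OF S t(1)] numerical_monoid_mult[OF S t(2)] S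
      by (simp only: numerical_monoid_def)
    finally show ?thesis .
  qed
  then show thesis using that[of "t * t"] by auto
qed

lemma Max_set_plus:
  fixes A B :: "nat set"
  assumes "finite A" "A \<noteq> {}" "finite B" "B \<noteq> {}"
  shows "Max (A + B) = Max A + Max B"
proof (intro Max_eqI)
  show "Max A + Max B \<in> A + B"
    using assms by (intro set_plus_intro Max_in)
qed (use assms in \<open>auto simp: finite_set_plus elim!: set_plus_elim intro: add_mono\<close>)

lemma Min_set_plus:
  fixes A B :: "nat set"
  assumes "finite A" "A \<noteq> {}" "finite B" "B \<noteq> {}"
  shows "Min (A + B) = Min A + Min B"
proof (intro Min_eqI)
  show "Min A + Min B \<in> A + B"
    using assms by (intro set_plus_intro Min_in)
qed (use assms in \<open>auto simp: finite_set_plus elim!: set_plus_elim intro: add_mono\<close>)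

text \<open>The translates of the interval by \<open>Min A\<close> and by \<open>Max A\<close>
  already cover the right-hand side: they overlap because the length \<open>K\<close> is at least
  \<open>Max A\<close>. The sum thus remembers only the two extremes of \<open>A\<close>.\<close>

lemma set_plus_interval:
  fixes A :: "nat set"
  assumes A: "finite A" "A \<noteq> {}" and K: "Max A \<le> K"
  shows "A + {c..c + K} = {Min A + c..Max A + (c + K)}"
proof (intro equalityI subsetI)
  fix x assume "x \<in> A + {c..c + K}"
  then show "x \<in> {Min A + c..Max A + (c + K)}"
    using A by (auto elim!: set_plus_elim intro: add_mono)
next
  fix x assume x: "x \<in> {Min A + c..Max A + (c + K)}"
  show "x \<in> A + {c..c + K}"
  proof (cases "x \<le> Min A + (c + K)")
    case True
    then have "x = Min A + (x - Min A)" "x - Min A \<in> {c..c + K}" using x by auto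
    then show ?thesis using A set_plus_intro[of "Min A" A] by (metis Min_in)
  next
    case False
    then have "x = Max A + (x - Max A)" "x - Max A \<in> {c..c + K}" using x K by auto
    then show ?thesis using A set_plus_intro[of "Max A" A] by (metis Max_in)
  qed
qed

text \<open>Elements up to \<open>K\<close> are reached by adding \<open>0\<close>. An element
  beyond \<open>K\<close> stays at or above \<open>c\<close> after \<open>Max A\<close> is
  subtracted, hence in \<open>S\<close>. The sum thus remembers only \<open>Max A\<close>.\<close>

lemma set_plus_initial_segment:
  assumes S: "numerical_monoid S" and c: "{c..} \<subseteq> S"
    and A: "finite A" "A \<subseteq> S" "0 \<in> A" and K: "c + Max A \<le> K"
  shows "A + (S \<inter> {..K}) = S \<inter> {..Max A + K}"
proof (intro equalityI subsetI)
  fix x assume "x \<in> A + (S \<inter> {..K})"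
  then show "x \<in> S \<inter> {..Max A + K}"
    using A S by (auto simp: numerical_monoid_def elim!: set_plus_elim intro: add_mono)
next
  fix x assume x: "x \<in> S \<inter> {..Max A + K}"
  show "x \<in> A + (S \<inter> {..K})"
  proof (cases "x \<le> K")
    case True
    then show ?thesis using x A set_plus_intro[of 0 A x] by simp
  next
    case False
    then have "x = Max A + (x - Max A)" "x - Max A \<in> S \<inter> {..K}" using x K c by auto
    moreover have "Max A \<in> A" using A by (intro Max_in) auto
    ultimately show ?thesis using set_plus_intro[of "Max A" A] by metis
  qed
qed

lemma groth_group_Pfin:
  assumes S: "numerical_monoid S"
  shows "groth_group (Pfin S) \<cong> integer_group \<times>\<times> integer_group"
proof -
  interpret comm_monoid "Pfin S" by (rule comm_monoid_Pfin[OF S])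
  obtain c where c: "{c..} \<subseteq> S" using numerical_monoid_conductor[OF S] .
  show ?thesis
  proof (rule groth_group_iso[where f = "\<lambda>A. (int (Max A), int (Min A))"])
    show "comm_group (integer_group \<times>\<times> integer_group)"
    proof (rule group.group_comm_groupI)
      show "group (integer_group \<times>\<times> integer_group)"
        by (intro DirProd_group group_integer_group)
    qed (auto simp: integer_group_def DirProd_def)
    show "(\<lambda>A. (int (Max A), int (Min A))) \<in> hom (Pfin S) (integer_group \<times>\<times> integer_group)"
      by (auto simp: hom_def Pfin_def Max_set_plus Min_set_plus)
  next
    fix A B
    assume AB: "A \<in> carrier (Pfin S)" "B \<in> carrier (Pfin S)"
      and "(int (Max A), int (Min A)) = (int (Max B), int (Min B))"
    then have "A + {c..c + Max A} = B + {c..c + Max A}"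
      by (simp add: Pfin_def set_plus_interval)
    then show "\<exists>E\<in>carrier (Pfin S). A \<otimes>\<^bsub>Pfin S\<^esub> E = B \<otimes>\<^bsub>Pfin S\<^esub> E"
      using c by (intro bexI[of _ "{c..c + Max A}"]) (auto simp: Pfin_def)
  next
    fix k :: "int \<times> int"
    obtain x y where k: "k = (x, y)" by fastforce
    \<comment> \<open>The positive and negative parts of x and y go into \<open>A\<close> and
      \<open>B\<close> respectively. The term \<bar>y\<bar> keeps the second element at least as
      large as the first, so it is the maximum, and the shift by \<open>c\<close> puts everything in
      \<open>S\<close>. Both cancel in the differences.\<close>
    define A where "A = {c + nat y, c + nat \<bar>y\<bar> + nat x}"
    define B where "B = {c + nat (- y), c + nat \<bar>y\<bar> + nat (- x)}"
    have "A \<in> carrier (Pfin S)" "B \<in> carrier (Pfin S)"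
      using c by (auto simp: A_def B_def Pfin_def)
    moreover have "k \<otimes>\<^bsub>integer_group \<times>\<times> integer_group\<^esub> (int (Max B), int (Min B))
        = (int (Max A), int (Min A))"
      by (auto simp: k A_def B_def DirProd_def integer_group_def max_def min_def)
    ultimately show "\<exists>A\<in>carrier (Pfin S). \<exists>B\<in>carrier (Pfin S).
        k \<otimes>\<^bsub>integer_group \<times>\<times> integer_group\<^esub> (int (Max B), int (Min B)) = (int (Max A), int (Min A))"
      by blast
  qed
qed

text \<open>The minimum of a set containing \<open>0\<close> is \<open>0\<close>, so only the
  coordinate given by the maximum survives.\<close>

lemma groth_group_Pfin0:
  assumes S: "numerical_monoid S"
  shows "groth_group (Pfin0 S) \<cong> integer_group"
proof -
  interpret comm_monoid "Pfin0 S" by (rule comm_monoid_Pfin0[OF S])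
  obtain c where c: "{c..} \<subseteq> S" using numerical_monoid_conductor[OF S] .
  have S0: "0 \<in> S" using S by (simp add: numerical_monoid_def)
  show ?thesis
  proof (rule groth_group_iso[where f = "\<lambda>A. int (Max A)"])
    show "comm_group integer_group"
      by (rule abelian_integer_group)
    show "(\<lambda>A. int (Max A)) \<in> hom (Pfin0 S) integer_group"
      by (auto simp: hom_def Pfin0_def Pfin_def Max_set_plus)
  next
    fix A B
    assume AB: "A \<in> carrier (Pfin0 S)" "B \<in> carrier (Pfin0 S)" and "int (Max A) = int (Max B)"
    then have "A + (S \<inter> {..c + Max A}) = B + (S \<inter> {..c + Max A})"
      by (simp add: Pfin0_def Pfin_def set_plus_initial_segment[OF S c])
    then show "\<exists>E\<in>carrier (Pfin0 S). A \<otimes>\<^bsub>Pfin0 S\<^esub> E = B \<otimes>\<^bsub>Pfin0 S\<^esub> E"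
      using S0 by (intro bexI[of _ "S \<inter> {..c + Max A}"]) (auto simp: Pfin0_def Pfin_def)
  next
    fix k :: int
    \<comment> \<open>The maxima differ by \<open>nat k\<close> - \<open>nat (- k)\<close> = k, and
      the common shift by \<open>c\<close> puts them in \<open>S\<close>.\<close>
    define A where "A = {0, c + nat k}"
    define B where "B = {0, c + nat (- k)}"
    have "A \<in> carrier (Pfin0 S)" "B \<in> carrier (Pfin0 S)"
      using c S0 by (auto simp: A_def B_def Pfin0_def Pfin_def)
    moreover have "k \<otimes>\<^bsub>integer_group\<^esub> int (Max B) = int (Max A)"
      by (simp add: A_def B_def)
    ultimately show "\<exists>A\<in>carrier (Pfin0 S). \<exists>B\<in>carrier (Pfin0 S).
        k \<otimes>\<^bsub>integer_group\<^esub> int (Max B) = int (Max A)"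
      by blast
  qed
qed

theorem theorem3p3:
  fixes S :: "nat set"
  assumes "numerical_monoid S"
  shows "groth_group (Pfin S) \<cong> integer_group \<times>\<times> integer_group \<and>
         groth_group (Pfin0 S) \<cong> integer_group"
  using groth_group_Pfin[OF assms] groth_group_Pfin0[OF assms] by (rule conjI)

end
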